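(* For every graph $G$ with vertex set $V=\{1,\dots,n\}$ and $m$ edges, there exists a graph $R$ on the same vertex set $V$ with exactly $m$ edges such that $\Delta(R)\le\delta(R)+1$ and $|E(G)\,\triangle\,E(R)|\le s(G)$. In particular, if $2m/n$ is an integer then $R$ is $(2m/n)$-regular.
   Context: $d(u)$ denotes the degree of vertex $u$; $\Delta$ and $\delta$ denote maximum and minimum degree. For a graph $G$ with $n$ vertices and $m$ edges, $s(G)=\sum_{u\in V(G)}\left|d(u)-\frac{2m}{n}\right|$. "R differs from G in at most k edges" means the symmetric difference of the edge sets has at most $k$ elements. *)

theory Defs
  imports Complex_Main "HOL-Library.Ramsey"
begin

text \<open>
  A finite simple graph is a finite vertex set \<open>V\<close> together with a set \<open>E\<close> of two-element
  subsets of \<open>V\<close>.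
\<close>

definition simple_graph :: "'a set \<Rightarrow> 'a set set \<Rightarrow> bool" where
  "simple_graph V E \<longleftrightarrow> finite V \<and> E \<subseteq> nsets V 2"

definition vertex_degree :: "'a set set \<Rightarrow> 'a \<Rightarrow> nat" where
  "vertex_degree E u = card {e \<in> E. u \<in> e}"

text \<open>The maximum and minimum degree are meaningful only for finite, nonempty \<open>V\<close>.\<close>

definition max_degree :: "'a set \<Rightarrow> 'a set set \<Rightarrow> nat" where
  "max_degree V E = Max (vertex_degree E ` V)"

definition min_degree :: "'a set \<Rightarrow> 'a set set \<Rightarrow> nat" where
  "min_degree V E = Min (vertex_degree E ` V)"

definition regular_graph :: "'a set \<Rightarrow> 'a set set \<Rightarrow> nat \<Rightarrow> bool" where
  "regular_graph V E k \<longleftrightarrow> (\<forall>u\<in>V. vertex_degree E u = k)"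

definition degree_deviation :: "'a set \<Rightarrow> 'a set set \<Rightarrow> real" where
  "degree_deviation V E =
     (\<Sum>u\<in>V. \<bar>real (vertex_degree E u) - 2 * real (card E) / real (card V)\<bar>)"

end

theory Submission
  imports Defs
begin

text \<open>
  Put \<open>q = \<lfloor>2m/n\<rfloor>\<close> and let \<open>P = \<Sum>\<^sub>u max 0 (q - d(u))\<close> and \<open>Q = \<Sum>\<^sub>u max 0 (d(u) - (q + 1))\<close>.
  As the deviations from the mean cancel, the positive and the negative ones both add up to
  \<open>s(G)/2\<close>, so \<open>max P Q \<le> s(G)/2\<close>. If \<open>d(v) < d(u)\<close>, some neighbour \<open>w \<noteq> v\<close> of \<open>u\<close> is not adjacent
  to \<open>v\<close>, and replacing the edge \<open>uw\<close> by \<open>vw\<close> moves one unit of degree from \<open>u\<close> to \<open>v\<close>. While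
  \<open>max P Q > 0\<close>, the mean degree lying in \<open>[q, q + 1)\<close> guarantees a choice of \<open>u\<close> and \<open>v\<close> for which
  such a switch lowers \<open>max P Q\<close>. Hence at most \<open>s(G)/2\<close> switches, each changing two edges,
  bring all degrees into \<open>{q, q + 1}\<close>.
\<close>

section \<open>Degree counting and the edge switch\<close>

lemma simple_graph_finite:
  assumes "simple_graph V E"
  shows "finite V" "finite E"
  using assms finite_subset[of E "Pow V"]
  by (auto simp: simple_graph_def nsets_def)

lemma handshake:
  assumes "simple_graph V E"
  shows "(\<Sum>u\<in>V. vertex_degree E u) = 2 * card E"
proof -
  note fin = simple_graph_finite[OF assms]
  have "(\<Sum>u\<in>V. vertex_degree E u) = (\<Sum>u\<in>V. \<Sum>e\<in>E. if u \<in> e then 1 else 0)"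
    using fin by (simp add: vertex_degree_def sum.If_cases Int_def)
  also have "\<dots> = (\<Sum>e\<in>E. \<Sum>u\<in>V. if u \<in> e then 1 else 0)"
    by (rule sum.swap)
  also have "\<dots> = (\<Sum>e\<in>E. 2)"
  proof (rule sum.cong)
    fix e assume "e \<in> E"
    then have "e \<subseteq> V" "card e = 2"
      using assms by (auto simp: simple_graph_def nsets_def)
    moreover from this have "{u \<in> V. u \<in> e} = e" by auto
    ultimately show "(\<Sum>u\<in>V. if u \<in> e then 1 else 0) = (2::nat)"
      using fin by (simp add: sum.If_cases Int_def)
  qed simp
  finally show ?thesis by simp
qed

text \<open>The map sending \<open>w\<close> to \<open>{u, w}\<close> is a bijection from neighbours
  to incident edges. Neighbourhoods, unlike sets of incident edges, can be compared between two
  vertices.\<close>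

lemma vertex_degree_eq_card_neighbours:
  assumes "simple_graph V E"
  shows "vertex_degree E u = card {w. {u, w} \<in> E}"
proof -
  have "\<exists>w. e = {u, w}" if "e \<in> E" "u \<in> e" for e
  proof -
    have "card e = 2" using assms that by (auto simp: simple_graph_def nsets_def)
    with that(2) show ?thesis by (auto simp: card_2_iff)
  qed
  then have "{e \<in> E. u \<in> e} = (\<lambda>w. {u, w}) ` {w. {u, w} \<in> E}" by blast
  moreover have "inj_on (\<lambda>w. {u, w}) {w. {u, w} \<in> E}"
    by (auto simp: inj_on_def doubleton_eq_iff)
  ultimately show ?thesis
    by (simp add: vertex_degree_def card_image)
qed

text \<open>Adjacency is symmetric, so deleting \<open>v\<close> from \<open>N u\<close> and
  \<open>u\<close> from \<open>N v\<close> removes one element from both sets or from neither. The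
  first set stays strictly larger and cannot lie inside the second.\<close>

lemma ex_private_neighbour:
  assumes "simple_graph V E" and "vertex_degree E v < vertex_degree E u"
  obtains w where "{u, w} \<in> E" "{v, w} \<notin> E" "w \<noteq> v"
proof -
  define N where "N x = {w. {x, w} \<in> E}" for x
  have N: "w \<in> V \<and> w \<noteq> x" if "w \<in> N x" for x w
    using that assms(1) by (auto simp: N_def simple_graph_def nsets_def)
  have fin: "finite (N x)" for x
    using N finite_subset[of "N x" V] simple_graph_finite(1)[OF assms(1)] by blast
  have less: "card (N v) < card (N u)"
    using assms vertex_degree_eq_card_neighbours[OF assms(1)] by (simp add: N_def)
  have sym: "v \<in> N u \<longleftrightarrow> u \<in> N v" by (simp add: N_def insert_commute)
  have "\<not> N u - {v} \<subseteq> N v - {u}"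
  proof
    assume "N u - {v} \<subseteq> N v - {u}"
    then have "card (N u - {v}) \<le> card (N v - {u})" using fin by (intro card_mono) auto
    moreover have "card (N v) > 0" if "u \<in> N v" using that fin card_gt_0_iff by blast
    ultimately show False using less sym fin by (auto simp: card_Diff_singleton_if split: if_splits)
  qed
  \<comment> \<open>The element outside \<open>N v - {u}\<close> is not \<open>u\<close> itself, as
    there are no loops, so it lies outside \<open>N v\<close>.\<close>
  then obtain w where "w \<in> N u" "w \<noteq> v" "w \<notin> N v" using N by blast
  then show thesis using that by (simp add: N_def)
qed

text \<open>The common endpoint \<open>w\<close> loses \<open>{u, w}\<close> and gains
  \<open>{v, w}\<close>, so only the degrees of \<open>u\<close> and \<open>v\<close>
  change.\<close>

lemma degree_switch:
  assumes G: "simple_graph V G" and v: "v \<in> V"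
    and less: "vertex_degree G v < vertex_degree G u"
  obtains H where "simple_graph V H" "card H = card G"
    "vertex_degree H = (vertex_degree G)
       (u := vertex_degree G u - 1, v := vertex_degree G v + 1)"
    "card (sym_diff G H) \<le> 2"
proof -
  obtain w where w: "{u, w} \<in> G" "{v, w} \<notin> G" "w \<noteq> v"
    using ex_private_neighbour[OF G less] .
  have w': "w \<in> V" "w \<noteq> u" using w(1) G by (auto simp: simple_graph_def nsets_def)
  have ne: "u \<noteq> v" using less by auto
  note fin = simple_graph_finite(2)[OF G]
  define H where "H = insert {v, w} (G - {{u, w}})"
  have "simple_graph V H"
    using G v w w' by (auto simp: H_def simple_graph_def nsets_def)
  moreover have "card G > 0" using w(1) fin card_gt_0_iff by blast
  then have "card H = card G"
    using w fin by (simp add: H_def)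
  moreover have "vertex_degree H x = ((vertex_degree G)
       (u := vertex_degree G u - 1, v := vertex_degree G v + 1)) x" for x
  proof -
    have finx: "finite {e \<in> G. x \<in> e}" using fin by simp
    consider "x = u" | "x = v" | "x = w" | "x \<notin> {u, v, w}" by blast
    then show ?thesis
    proof cases
      case 1
      then have "{e \<in> H. x \<in> e} = {e \<in> G. x \<in> e} - {{u, w}}"
        using ne w' by (auto simp: H_def)
      then show ?thesis using 1 ne w(1) finx by (simp add: vertex_degree_def)
    next
      case 2
      then have "{e \<in> H. x \<in> e} = insert {v, w} {e \<in> G. x \<in> e}"
        using ne w by (auto simp: H_def)
      then show ?thesis using 2 w(2) finx by (simp add: vertex_degree_def)
    next
      case 3
      then have "{e \<in> H. x \<in> e} = insert {v, w} ({e \<in> G. x \<in> e} - {{u, w}})"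
        by (auto simp: H_def)
      \<comment> \<open>The new count is \<open>card - 1 + 1\<close> with truncated subtraction;
        positivity makes it the old one.\<close>
      moreover have "card {e \<in> G. x \<in> e} > 0"
        using 3 w(1) finx card_gt_0_iff by blast
      ultimately show ?thesis using 3 w w' finx by (simp add: vertex_degree_def)
    next
      case 4
      then have "{e \<in> H. x \<in> e} = {e \<in> G. x \<in> e}" by (auto simp: H_def)
      then show ?thesis using 4 by (simp add: vertex_degree_def)
    qed
  qed
  then have "vertex_degree H = (vertex_degree G)
       (u := vertex_degree G u - 1, v := vertex_degree G v + 1)" by blast
  moreover have "card (sym_diff G H) \<le> card {{u, w}, {v, w}}"
    by (intro card_mono) (auto simp: H_def)
  then have "card (sym_diff G H) \<le> 2"
    by (rule order_trans) (simp add: card_insert_if)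
  ultimately show thesis using that by blast
qed

lemma card_sym_diff_triangle:
  assumes "finite A" "finite B" "finite C"
  shows "card (sym_diff A C) \<le> card (sym_diff A B) + card (sym_diff B C)"
proof -
  have "card (sym_diff A C) \<le> card (sym_diff A B \<union> sym_diff B C)"
    using assms by (intro card_mono) auto
  then show ?thesis using card_Un_le order_trans by blast
qed

section \<open>Deficit and excess: repair by switches and comparison with s(G)\<close>

definition deficit :: "'a set \<Rightarrow> nat \<Rightarrow> ('a \<Rightarrow> nat) \<Rightarrow> nat" where
  "deficit V q d = (\<Sum>u\<in>V. q - d u)"

text \<open>Truncated subtraction makes this Q and \<open>deficit\<close> P. The thresholds
  \<open>q\<close> and \<open>q + 1\<close> differ because both values are allowed as final
  degrees.\<close>

definition excess :: "'a set \<Rightarrow> nat \<Rightarrow> ('a \<Rightarrow> nat) \<Rightarrow> nat" where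
  "excess V q d = (\<Sum>u\<in>V. d u - (q + 1))"

lemma sum_two:
  fixes f :: "'a \<Rightarrow> nat"
  assumes "finite V" "u \<in> V" "v \<in> V" "u \<noteq> v"
  shows "sum f V = f u + f v + sum f (V - {u, v})"
proof -
  have "sum f V = sum f (V - {u, v}) + sum f {u, v}"
    using assms by (intro sum.subset_diff) auto
  then show ?thesis using assms by simp
qed

lemma exists_switch_pair:
  assumes V: "finite V"
    and lower: "card V * q \<le> sum d V" and upper: "sum d V < card V * (q + 1)"
    and pos: "max (deficit V q d) (excess V q d) > 0"
  obtains u v where "u \<in> V" "v \<in> V" "d v < d u"
    "max (deficit V q (d(u := d u - 1, v := d v + 1)))
         (excess V q (d(u := d u - 1, v := d v + 1))) < max (deficit V q d) (excess V q d)"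
proof -
  have below: "\<exists>x\<in>V. d x < q" if "deficit V q d > 0"
    using that by (rule contrapos_pp) (auto simp: deficit_def not_less)
  have above: "\<exists>x\<in>V. d x > q + 1" if "excess V q d > 0"
    using that by (rule contrapos_pp) (auto simp: excess_def not_less)
  \<comment> \<open>A degree below \<open>q\<close> must be compensated above \<open>q\<close>, or
    the sum would drop below \<open>card V * q\<close>.\<close>
  have high: "\<exists>u\<in>V. d u > q" if short: "deficit V q d > 0"
  proof (rule ccontr)
    assume "\<not> ?thesis"
    then have le: "\<forall>x\<in>V. d x \<le> q" by auto
    have "sum d V < (\<Sum>x\<in>V. q)"
      using V le below[OF short] by (rule sum_strict_mono_ex1)
    with lower show False by simp
  qed
  have low: "\<exists>v\<in>V. d v \<le> q"
  proof (rule ccontr)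
    assume "\<not> ?thesis"
    then have "(\<Sum>x\<in>V. q + 1) \<le> sum d V" by (intro sum_mono) auto
    with upper show False by simp
  qed
  \<comment> \<open>A vertex that contributes to the excess is preferred. If there is none, degree
    \<open>q + 1\<close> serves: lowering it to \<open>q\<close> creates no deficit. The choice of
    \<open>v\<close> below is dual.\<close>
  have "\<exists>u\<in>V. q < d u \<and> (excess V q d > 0 \<longrightarrow> q + 1 < d u)"
  proof (cases "excess V q d > 0")
    case True
    from above[OF this] obtain u where "u \<in> V" "q + 1 < d u" ..
    then show ?thesis by (intro bexI[of _ u]) auto
  next
    case False
    with pos have "deficit V q d > 0" by simp
    with high False show ?thesis by simp
  qed
  then obtain u where u: "u \<in> V" "q < d u" "excess V q d > 0 \<longrightarrow> q + 1 < d u"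
    by (elim bexE conjE)
  have "\<exists>v\<in>V. d v \<le> q \<and> (deficit V q d > 0 \<longrightarrow> d v < q)"
  proof (cases "deficit V q d > 0")
    case True
    from below[OF this] obtain v where "v \<in> V" "d v < q" ..
    then show ?thesis by (intro bexI[of _ v]) auto
  next
    case False
    with low show ?thesis by simp
  qed
  then obtain v where v: "v \<in> V" "d v \<le> q" "deficit V q d > 0 \<longrightarrow> d v < q"
    by (elim bexE conjE)
  have less: "d v < d u" using u(2) v(2) by simp
  then have ne: "u \<noteq> v" by auto
  define d' where "d' = d(u := d u - 1, v := d v + 1)"
  have d': "d' u = d u - 1" "d' v = d v + 1" using ne by (auto simp: d'_def)
  have rest: "(\<Sum>x\<in>V - {u, v}. q - d' x) = (\<Sum>x\<in>V - {u, v}. q - d x)"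
    "(\<Sum>x\<in>V - {u, v}. d' x - (q + 1)) = (\<Sum>x\<in>V - {u, v}. d x - (q + 1))"
    by (auto intro!: sum.cong simp: d'_def)
  note split = sum_two[OF V u(1) v(1) ne]
  \<comment> \<open>Truncation covers both cases: a positive deficit drops by one at
    \<open>v\<close>, a zero deficit stays zero. The same holds for the excess at \<open>u\<close>,
    so the maximum drops.\<close>
  have "deficit V q d' = deficit V q d - 1"
  proof (cases "deficit V q d > 0")
    case True
    then show ?thesis
      using u(2) v(3)[rule_format, OF True] unfolding deficit_def split rest(1) d' by simp
  next
    case False
    then show ?thesis
      using u(2) unfolding deficit_def split rest(1) d' by simp
  qed
  moreover have "excess V q d' = excess V q d - 1"
  proof (cases "excess V q d > 0")
    case True
    then show ?thesis
      using v(2) u(3)[rule_format, OF True] unfolding excess_def split rest(2) d' by simp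
  next
    case False
    then show ?thesis
      using v(2) unfolding excess_def split rest(2) d' by simp
  qed
  ultimately have "max (deficit V q d') (excess V q d') < max (deficit V q d) (excess V q d)"
    using pos by linarith
  then show thesis
    unfolding d'_def by (rule that[OF u(1) v(1) less])
qed

text \<open>Induction on the maximum of deficit and excess: a switch lowers it by at least one and
  changes at most two edges, whence the factor 2. The edge count is preserved, so the bounds on
  \<open>q\<close> pass to the switched graph.\<close>

lemma near_regular_rewiring:
  assumes "simple_graph V G"
    and "card V * q \<le> 2 * card G" and "2 * card G < card V * (q + 1)"
  shows "\<exists>R. simple_graph V R \<and> card R = card G \<and>
           (\<forall>u\<in>V. q \<le> vertex_degree R u \<and> vertex_degree R u \<le> q + 1) \<and>
           card (sym_diff G R) \<le> 2 * max (deficit V q (vertex_degree G)) (excess V q (vertex_degree G))"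
  using assms
proof (induction "max (deficit V q (vertex_degree G)) (excess V q (vertex_degree G))"
    arbitrary: G rule: less_induct)
  case less
  note fin = simple_graph_finite[OF less.prems(1)]
  show ?case
  proof (cases "max (deficit V q (vertex_degree G)) (excess V q (vertex_degree G)) > 0")
    case False
    then have "\<forall>u\<in>V. q \<le> vertex_degree G u \<and> vertex_degree G u \<le> q + 1"
      using fin by (auto simp: deficit_def excess_def)
    then show ?thesis using less.prems by (intro exI[of _ G]) auto
  next
    case True
    let ?d = "vertex_degree G"
    have "sum ?d V = 2 * card G" using handshake[OF less.prems(1)] .
    then have "card V * q \<le> sum ?d V" "sum ?d V < card V * (q + 1)" using less.prems by simp_all
    from exists_switch_pair[OF fin(1) this True] obtain u v where uv: "u \<in> V" "v \<in> V" "?d v < ?d u"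
      and dec: "max (deficit V q (?d(u := ?d u - 1, v := ?d v + 1)))
          (excess V q (?d(u := ?d u - 1, v := ?d v + 1))) < max (deficit V q ?d) (excess V q ?d)"
      .
    obtain H where H: "simple_graph V H" "card H = card G" "card (sym_diff G H) \<le> 2"
      and deg: "vertex_degree H = (vertex_degree G)
         (u := vertex_degree G u - 1, v := vertex_degree G v + 1)"
      using degree_switch[OF less.prems(1) uv(2,3)] by blast
    note dec = dec[folded deg]
    from less.hyps[OF dec H(1)] less.prems H(2) obtain R where
      R: "simple_graph V R" "card R = card G"
        "\<forall>u\<in>V. q \<le> vertex_degree R u \<and> vertex_degree R u \<le> q + 1"
        "card (sym_diff H R) \<le> 2 * max (deficit V q (vertex_degree H)) (excess V q (vertex_degree H))"
      by auto
    have "card (sym_diff G R) \<le> card (sym_diff G H) + card (sym_diff H R)"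
      using simple_graph_finite(2) less.prems(1) H(1) R(1) by (intro card_sym_diff_triangle) auto
    also have "\<dots> \<le> 2 * max (deficit V q (vertex_degree G)) (excess V q (vertex_degree G))"
      using H(3) R(4) dec by linarith
    finally show ?thesis using R by blast
  qed
qed

text \<open>With mean \<open>a\<close>, every degree d satisfies 2 max(0, q - d) + (d - a) \<le> |d
  - a| because q \<le> a. Summing cancels the terms d - a. The excess is treated with the opposite
  sign, using a \<le> q + 1.\<close>

lemma deficit_excess_le_degree_deviation:
  assumes G: "simple_graph V G" and ne: "V \<noteq> {}"
    and lower: "card V * q \<le> 2 * card G" and upper: "2 * card G \<le> card V * (q + 1)"
  shows "2 * real (max (deficit V q (vertex_degree G)) (excess V q (vertex_degree G)))
           \<le> degree_deviation V G"
proof -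
  define a where "a = 2 * real (card G) / real (card V)"
  have pos: "real (card V) > 0" using simple_graph_finite(1)[OF G] ne by (simp add: card_gt_0_iff)
  have "real (card V) * real q \<le> 2 * real (card G)"
    using of_nat_mono[where 'a=real, OF lower] by simp
  then have qa: "real q \<le> a" using pos by (simp add: a_def field_simps)
  have "2 * real (card G) \<le> real (card V) * (real q + 1)"
    using of_nat_mono[where 'a=real, OF upper] by (simp add: distrib_left)
  then have aq: "a \<le> real q + 1" using pos by (simp add: a_def field_simps)
  have "(\<Sum>u\<in>V. real (vertex_degree G u)) = 2 * real (card G)"
    using handshake[OF G] by (metis of_nat_mult of_nat_numeral of_nat_sum)
  then have zero: "(\<Sum>u\<in>V. real (vertex_degree G u) - a) = 0"
    using pos by (simp add: sum_subtractf a_def)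
  have "(\<Sum>u\<in>V. 2 * real (q - vertex_degree G u) + (real (vertex_degree G u) - a))
        \<le> degree_deviation V G"
    unfolding degree_deviation_def a_def[symmetric] using qa by (intro sum_mono) linarith
  then have "2 * real (deficit V q (vertex_degree G)) \<le> degree_deviation V G"
    using zero by (simp add: deficit_def sum.distrib flip: sum_distrib_left)
  moreover
  have "(\<Sum>u\<in>V. 2 * real (vertex_degree G u - (q + 1)) - (real (vertex_degree G u) - a))
        \<le> degree_deviation V G"
    unfolding degree_deviation_def a_def[symmetric] using aq by (intro sum_mono) linarith
  then have "2 * real (excess V q (vertex_degree G)) \<le> degree_deviation V G"
    using zero by (simp add: excess_def sum_subtractf[of "\<lambda>u. 2 * real (vertex_degree G u - Suc q)"]
        flip: sum_distrib_left)
  ultimately show ?thesis by (simp add: max_def)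
qed

theorem theorem1:
  fixes n m :: nat and V :: "nat set" and G :: "nat set set"
  assumes "n \<ge> 1" and "V = {1..n}"
    and "simple_graph V G" and "card G = m"
  shows "\<exists>R :: nat set set.
           simple_graph V R \<and> card R = m \<and>
           max_degree V R \<le> min_degree V R + 1 \<and>
           real (card (sym_diff G R)) \<le> degree_deviation V G \<and>
           (\<forall>k::nat. 2 * real m / real n = real k \<longrightarrow> regular_graph V R k)"
proof -
  have V: "finite V" "V \<noteq> {}" "card V = n" using assms by auto
  \<comment> \<open>The integer part of the mean degree, so the mean lies in [q, q + 1).\<close>
  define q where "q = 2 * m div n"
  have lower: "card V * q \<le> 2 * card G"
    using V assms(4) by (simp add: q_def)
  have upper: "2 * card G < card V * (q + 1)"
    using V assms dividend_less_times_div[of n "2 * m"] by (simp add: q_def)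
  obtain R where R: "simple_graph V R" "card R = m"
      "\<forall>u\<in>V. q \<le> vertex_degree R u \<and> vertex_degree R u \<le> q + 1"
      "card (sym_diff G R) \<le> 2 * max (deficit V q (vertex_degree G)) (excess V q (vertex_degree G))"
    using near_regular_rewiring[OF assms(3) lower upper] assms(4) by auto
  have "max_degree V R \<le> q + 1"
    using R(3) V by (simp add: max_degree_def)
  moreover have "q \<le> min_degree V R"
    using R(3) V by (simp add: min_degree_def)
  moreover have "real (card (sym_diff G R)) \<le> degree_deviation V G"
    using deficit_excess_le_degree_deviation[OF assms(3) V(2) lower less_imp_le[OF upper]]
      of_nat_mono[where 'a=real, OF R(4)] by simp
  moreover have "regular_graph V R k" if "2 * real m / real n = real k" for k
  proof -
    have "real (2 * m) = real (n * k)" using that assms(1) by (simp add: field_simps)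
    then have nk: "2 * m = n * k" by (simp only: of_nat_eq_iff)
    then have "k = q" using assms(1) by (simp add: q_def)
    \<comment> \<open>The mean is now exactly \<open>q\<close> and no degree is below
      \<open>q\<close>, so a single larger degree would push the sum above 2m.\<close>
    have "vertex_degree R u = q" if "u \<in> V" for u
    proof (rule ccontr)
      assume "vertex_degree R u \<noteq> q"
      with R(3) that have "\<forall>x\<in>V. q \<le> vertex_degree R x" "\<exists>x\<in>V. q < vertex_degree R x"
        by (auto simp: le_less)
      with V(1) have "(\<Sum>x\<in>V. q) < (\<Sum>x\<in>V. vertex_degree R x)"
        by (rule sum_strict_mono_ex1)
      with handshake[OF R(1)] R(2) V nk \<open>k = q\<close> show False by simp
    qed
    with \<open>k = q\<close> show ?thesis by (simp add: regular_graph_def)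
  qed
  ultimately show ?thesis using R(1,2) by (intro exI[of _ R]) auto
qed

end
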